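(* Let $S\subseteq[n-1]$. Then $$|\{\pi\in\mathcal S_n(321):\mathrm{Des}(\pi)\supseteq S\}|=\begin{cases} C_{n-|S|} & \mbox{if $S$ contains no two consecutive elements,} \\ 0 &\mbox{otherwise.}\end{cases}$$
   Context: $\mathcal S_n(321)$ is the set of $321$-avoiding permutations of $\{1,\dots,n\}$; $\mathrm{Des}(\pi)=\{i:\pi(i)>\pi(i+1)\}$; $C_m=\frac{1}{m+1}\binom{2m}{m}$ is the $m$-th Catalan number. *)

theory Defs
  imports Complex_Main "HOL-Combinatorics.Permutations"
begin

definition avoids_321 :: "nat \<Rightarrow> (nat \<Rightarrow> nat) \<Rightarrow> bool" where
  "avoids_321 n p \<longleftrightarrow>
     \<not> (\<exists>i j k. 1 \<le> i \<and> i < j \<and> j < k \<and> k \<le> n \<and> p i > p j \<and> p j > p k)"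

definition perms_321 :: "nat \<Rightarrow> (nat \<Rightarrow> nat) set" where
  "perms_321 n = {p. p permutes {1..n} \<and> avoids_321 n p}"

definition Des :: "nat \<Rightarrow> (nat \<Rightarrow> nat) \<Rightarrow> nat set" where
  "Des n p = {i \<in> {1..n - 1}. p i > p (i + 1)}"

text \<open>The division is exact, as the lemma after the definition shows.\<close>

definition catalan :: "nat \<Rightarrow> nat" where
  "catalan m = (2 * m choose m) div (m + 1)"

lemma of_nat_catalan:
  "real (catalan m) = 1 / (real m + 1) * real (2 * m choose m)"
proof -
  have "(m + 1) * (2 * m choose (m + 1)) = m * (2 * m choose m)"
    using binomial_absorb_comp[of "2 * m" m] binomial_absorption[of m "2 * m"]
    by auto
  then have "(m + 1) * (2 * m choose m) =
      (2 * m choose m) + (m + 1) * (2 * m choose (m + 1))"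
    by (simp add: algebra_simps)
  then have "(m + 1) dvd (2 * m choose m)"
    by (metis dvd_add_left_iff dvd_triv_left)
  then show ?thesis
    by (simp add: catalan_def real_of_nat_div add.commute)
qed

end

theory Submission
  imports Defs
begin

text \<open>
  Build 321-avoiding permutations by appending a new last value \<open>v\<close> (values \<open>\<ge> v\<close> move up by one).
  The result avoids 321 iff \<open>v\<close> exceeds every smaller entry of an inversion. If \<open>d\<close> (the slack) is
  \<open>n\<close> minus the largest such entry, the children of a permutation of slack \<open>d\<close> have slacks
  \<open>1, \<dots>, d + 1\<close>, each exactly once: the Catalan generating tree. A descent at \<open>n\<close> is created iff
  the previous step appended the top value and the present one does not. Such a forced pair of steps
  leads from slack \<open>d\<close> to \<open>d + 1\<close> and then to each of \<open>1, \<dots>, d + 1\<close>, just like a single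
  unconstrained step. Hence every forced descent shortens the tree by one level.
\<close>

section \<open>Inversion bottoms, slack and insertion of a last value\<close>

text \<open>The inserted 0 keeps \<open>Max\<close> defined when there are no inversions; such a
  permutation gets slack n.\<close>

definition inv_bottom :: "nat \<Rightarrow> (nat \<Rightarrow> nat) \<Rightarrow> nat" where
  "inv_bottom n p = Max (insert 0 {p j |j. \<exists>i. 1 \<le> i \<and> i < j \<and> j \<le> n \<and> p j < p i})"

definition slack :: "nat \<Rightarrow> (nat \<Rightarrow> nat) \<Rightarrow> nat" where
  "slack n p = n - inv_bottom n p"

definition ins :: "nat \<Rightarrow> nat \<Rightarrow> (nat \<Rightarrow> nat) \<Rightarrow> nat \<Rightarrow> nat" where
  "ins n v p i =
     (if i = Suc n then v else if i \<le> n \<and> v \<le> p i then Suc (p i) else p i)"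

lemma finite_inversion_bottoms:
  "finite {p j |j. \<exists>i. 1 \<le> i \<and> i < j \<and> j \<le> n \<and> p j < p (i::nat)}"
  by (rule finite_subset[of _ "p ` {..n}"]) auto

lemma inv_bottom_le_iff:
  "inv_bottom n p \<le> v \<longleftrightarrow> (\<forall>i j. 1 \<le> i \<and> i < j \<and> j \<le> n \<and> p j < p i \<longrightarrow> p j \<le> v)"
  unfolding inv_bottom_def
  by (subst Max_le_iff) (use finite_inversion_bottoms[of p n] in \<open>simp_all, blast\<close>)

text \<open>The excluded configuration is an inversion that becomes a 321 pattern once v is
  appended, hence this form.\<close>

lemma inv_bottom_less_iff:
  assumes "1 \<le> v"
  shows "inv_bottom n p < v \<longleftrightarrow>
    \<not> (\<exists>i j. 1 \<le> i \<and> i < j \<and> j \<le> n \<and> p j < p i \<and> v \<le> p j)"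
proof -
  have "x \<le> v - 1 \<longleftrightarrow> x < v" for x
    using assms by linarith
  then show ?thesis
    using inv_bottom_le_iff[of n p "v - 1"] by (simp only:) (meson not_le)
qed

lemma inv_bottom_leI:
  "(\<And>i j. 1 \<le> i \<Longrightarrow> i < j \<Longrightarrow> j \<le> n \<Longrightarrow> p j < p i \<Longrightarrow> p j \<le> v) \<Longrightarrow> inv_bottom n p \<le> v"
  unfolding inv_bottom_le_iff by blast

lemma le_inv_bottom: "1 \<le> i \<Longrightarrow> i < j \<Longrightarrow> j \<le> n \<Longrightarrow> p j < p i \<Longrightarrow> p j \<le> inv_bottom n p"
  using inv_bottom_le_iff by blast

lemma permutes_le:
  assumes "p permutes {1..n}" "i \<le> n"
  shows "p i \<le> (n::nat)"
proof (cases "i = 0")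
  case True
  then show ?thesis using permutes_not_in[OF assms(1), of i] by simp
next
  case False
  then show ?thesis using permutes_in_image[OF assms(1), of i] assms(2) by simp
qed

lemma permutes_pos:
  assumes "p permutes {1..n}" "1 \<le> i"
  shows "1 \<le> p (i::nat)"
proof (cases "i \<le> n")
  case True
  then show ?thesis using permutes_in_image[OF assms(1), of i] assms(2) by simp
next
  case False
  then show ?thesis using permutes_not_in[OF assms(1), of i] assms(2) by simp
qed

lemma inv_bottom_le: "p permutes {1..n} \<Longrightarrow> inv_bottom n p \<le> n"
  by (rule inv_bottom_leI) (auto intro: permutes_le)

section \<open>Appending and deleting the last entry\<close>

lemma permutes_ins:
  assumes p: "p permutes {1..n}" and v: "1 \<le> v" "v \<le> Suc n"
  shows "ins n v p permutes {1..Suc n}"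
proof (rule bij_imp_permutes)
  have inj: "p x = p y \<longleftrightarrow> x = y" for x y
    using inj_eq[OF permutes_inj[OF p]] .
  have "inj_on (ins n v p) {1..Suc n}"
  proof (rule inj_onI)
    fix x y assume "x \<in> {1..Suc n}" "y \<in> {1..Suc n}" "ins n v p x = ins n v p y"
    \<comment> \<open>Shifted values exceed v and unshifted ones stay below it, so equal values come
      from the same branch of \<open>ins\<close>. The first alternative covers x and y both equal to
      \<open>Suc n\<close>.\<close>
    then have "x = y \<or> p x = p y"
      by (simp add: ins_def split: if_splits)
    then show "x = y" unfolding inj by blast
  qed
  moreover have "ins n v p ` {1..Suc n} \<subseteq> {1..Suc n}"
  proof clarify
    fix x assume "x \<in> {1..Suc n}"
    then show "ins n v p x \<in> {1..Suc n}"
      using permutes_le[OF p, of x] permutes_pos[OF p, of x] v by (auto simp: ins_def)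
  qed
  ultimately show "bij_betw (ins n v p) {1..Suc n} {1..Suc n}"
    unfolding bij_betw_def by (metis endo_inj_surj finite_atLeastAtMost)
  show "ins n v p x = x" if "x \<notin> {1..Suc n}" for x
    using that permutes_not_in[OF p, of x] v by (auto simp: ins_def)
qed

lemma ins_eqD:
  assumes p: "p permutes {1..n}" and q: "q permutes {1..n}" and e: "ins n v p = ins n w q"
  shows "v = w" and "p = q"
proof -
  show vw: "v = w"
    using fun_cong[OF e, of "Suc n"] by (simp add: ins_def)
  show "p = q"
  proof
    fix i
    have "p i = q i" if "i \<le> n"
      using fun_cong[OF e, of i] that vw by (auto simp: ins_def split: if_splits)
    then show "p i = q i"
      by (cases "i \<le> n") (auto simp: permutes_not_in[OF p] permutes_not_in[OF q])
  qed
qed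

text \<open>Deleting the last entry and closing the gap left by its value inverts
  \<open>ins\<close>. No two entries merge, because the deleted value occurs nowhere else.\<close>

lemma permutes_Suc_ins:
  assumes q: "q permutes {1..Suc n}"
  obtains p where "p permutes {1..n}" "q = ins n (q (Suc n)) p"
proof -
  define v where "v = q (Suc n)"
  define p where "p i = (if i \<in> {1..n} then if v < q i then q i - 1 else q i else i)" for i
  have inj: "q x = q y \<longleftrightarrow> x = y" for x y
    using inj_eq[OF permutes_inj[OF q]] .
  have ne: "q i \<noteq> v" if "i \<in> {1..n}" for i
    using that unfolding v_def inj by simp
  have v: "1 \<le> v" "v \<le> Suc n"
    unfolding v_def using permutes_pos[OF q, of "Suc n"] permutes_le[OF q, of "Suc n"] by simp_all
  have "inj_on p {1..n}"
  proof (rule inj_onI)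
    fix x y assume a: "x \<in> {1..n}" "y \<in> {1..n}" "p x = p y"
    then have "q x = q y"
      using ne[OF a(1)] ne[OF a(2)] unfolding p_def by (simp split: if_splits)
    then show "x = y" unfolding inj .
  qed
  moreover have "p ` {1..n} \<subseteq> {1..n}"
  proof clarify
    fix x assume x: "x \<in> {1..n}"
    then have "1 \<le> q x" "q x \<le> Suc n"
      using permutes_le[OF q, of x] permutes_pos[OF q, of x] by simp_all
    then show "p x \<in> {1..n}"
      using ne[OF x] v x by (simp add: p_def) linarith
  qed
  ultimately have "bij_betw p {1..n} {1..n}"
    unfolding bij_betw_def by (metis endo_inj_surj finite_atLeastAtMost)
  then have "p permutes {1..n}"
    by (rule bij_imp_permutes) (simp only: p_def if_False)
  moreover have "q i = ins n v p i" for i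
  proof (cases "i \<in> {1..n}")
    case True
    then show ?thesis using ne[OF True] by (simp add: ins_def p_def) linarith
  next
    case False
    then show ?thesis
      using v permutes_not_in[OF q, of i] by (cases "i = Suc n") (auto simp: ins_def p_def v_def)
  qed
  ultimately show thesis
    using that unfolding v_def by blast
qed

section \<open>Avoidance, slack and descents under insertion\<close>

lemma ins_less_iff: "i \<le> n \<Longrightarrow> j \<le> n \<Longrightarrow> ins n v p i < ins n v p j \<longleftrightarrow> p i < p j"
  by (auto simp: ins_def)

lemma ins_last: "ins n v p (Suc n) = v"
  by (simp add: ins_def)

text \<open>The old entry equal to v is itself pushed up, whence the weak inequality on the
  right.\<close>

lemma last_less_ins_iff: "i \<le> n \<Longrightarrow> v < ins n v p i \<longleftrightarrow> v \<le> p i"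
  by (auto simp: ins_def)

lemma avoids_321D:
  "avoids_321 n p \<Longrightarrow> 1 \<le> i \<Longrightarrow> i < j \<Longrightarrow> j < k \<Longrightarrow> k \<le> n \<Longrightarrow> p j < p i \<Longrightarrow> p k < p j \<Longrightarrow> False"
  unfolding avoids_321_def by blast

lemma avoids_321I:
  "(\<And>i j k. 1 \<le> i \<Longrightarrow> i < j \<Longrightarrow> j < k \<Longrightarrow> k \<le> n \<Longrightarrow> p j < p i \<Longrightarrow> p k < p j \<Longrightarrow> False)
    \<Longrightarrow> avoids_321 n p"
  unfolding avoids_321_def by blast

text \<open>The first n entries keep their relative order, so a new 321 pattern must end in the
  appended v; its first two entries are then an inversion of p with smaller entry at least
  v.\<close>

lemma avoids_ins_iff:
  assumes v: "1 \<le> v"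
  shows "avoids_321 (Suc n) (ins n v p) \<longleftrightarrow> avoids_321 n p \<and> inv_bottom n p < v"
proof (intro iffI conjI)
  assume L: "avoids_321 (Suc n) (ins n v p)"
  show "avoids_321 n p"
  proof (rule avoids_321I)
    fix i j k assume a: "1 \<le> i" "i < j" "j < k" "k \<le> n" "p j < p i" "p k < p j"
    then have "ins n v p j < ins n v p i" "ins n v p k < ins n v p j"
      by (simp_all add: ins_less_iff)
    then show False using avoids_321D[OF L a(1-3)] a(4) by simp
  qed
  show "inv_bottom n p < v"
    unfolding inv_bottom_less_iff[OF v]
  proof clarify
    fix i j assume a: "1 \<le> i" "i < j" "j \<le> n" "p j < p i" "v \<le> p j"
    then have "ins n v p j < ins n v p i" "ins n v p (Suc n) < ins n v p j"
      by (simp_all add: ins_less_iff last_less_ins_iff ins_last)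
    then show False using avoids_321D[OF L a(1,2), of "Suc n"] a(3) by simp
  qed
next
  assume R: "avoids_321 n p \<and> inv_bottom n p < v"
  show "avoids_321 (Suc n) (ins n v p)"
  proof (rule avoids_321I)
    fix i j k
    assume a: "1 \<le> i" "i < j" "j < k" "k \<le> Suc n"
      "ins n v p j < ins n v p i" "ins n v p k < ins n v p j"
    then have ij: "p j < p i" by (simp add: ins_less_iff)
    show False
    proof (cases "k = Suc n")
      case True
      then have "j \<le> n" "v \<le> p j" using a by (simp_all add: last_less_ins_iff ins_last)
      then show False using R ij a(1,2) unfolding inv_bottom_less_iff[OF v] by blast
    next
      case False
      then have "k \<le> n" "p k < p j" using a by (simp_all add: ins_less_iff)
      then show False using avoids_321D[of n p i j k] R ij a(1-3) by blast
    qed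
  qed
qed

text \<open>Old inversion bottoms lie below v and so escape the shift. The only new candidate is v
  itself, an inversion bottom unless it is the top value.\<close>

lemma inv_bottom_ins:
  assumes p: "p permutes {1..n}" and v: "inv_bottom n p < v" "v \<le> Suc n"
  shows "inv_bottom (Suc n) (ins n v p) = (if v = Suc n then inv_bottom n p else v)"
proof -
  have small: "ins n v p j = p j" if "1 \<le> i" "i < j" "j \<le> n" "p j < p i" for i j
    using le_inv_bottom[of i j n p] that v by (auto simp: ins_def)
  have le: "p i \<le> n" if "i \<le> n" for i
    using permutes_le[OF p that] .
  show ?thesis
  proof (cases "v = Suc n")
    case True
    have "inv_bottom (Suc n) (ins n v p) \<le> inv_bottom n p"
    proof (rule inv_bottom_leI)
      fix i j assume a: "1 \<le> i" "i < j" "j \<le> Suc n" "ins n v p j < ins n v p i"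
      then have "j \<noteq> Suc n"
        using le[of i] True by (auto simp: ins_last last_less_ins_iff)
      then show "ins n v p j \<le> inv_bottom n p"
        using a small[of i j] le_inv_bottom[of i j n p] by (auto simp: ins_less_iff)
    qed
    moreover have "inv_bottom n p \<le> inv_bottom (Suc n) (ins n v p)"
    proof (rule inv_bottom_leI)
      fix i j assume a: "1 \<le> i" "i < j" "j \<le> n" "p j < p i"
      then have "ins n v p j < ins n v p i" by (simp add: ins_less_iff)
      with a show "p j \<le> inv_bottom (Suc n) (ins n v p)"
        using small[of i j] le_inv_bottom[of i j "Suc n" "ins n v p"] by simp
    qed
    ultimately show ?thesis using True by simp
  next
    case False
    then have vn: "v \<in> {1..n}" using v by auto
    have "inv_bottom (Suc n) (ins n v p) \<le> v"
    proof (rule inv_bottom_leI)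
      fix i j assume a: "1 \<le> i" "i < j" "j \<le> Suc n" "ins n v p j < ins n v p i"
      show "ins n v p j \<le> v"
      proof (cases "j = Suc n")
        case False
        then show ?thesis
          using a small[of i j] le_inv_bottom[of i j n p] v by (auto simp: ins_less_iff)
      qed (simp add: ins_last)
    qed
    \<comment> \<open>The entry of p equal to v is raised to \<open>Suc v\<close> and forms an
      inversion with the appended v.\<close>
    moreover have "v \<in> p ` {1..n}"
      unfolding permutes_image[OF p] by (rule vn)
    then obtain i where i: "i \<in> {1..n}" "p i = v"
      by blast
    then have "ins n v p (Suc n) \<le> inv_bottom (Suc n) (ins n v p)"
      by (intro le_inv_bottom[of i]) (auto simp: ins_last last_less_ins_iff)
    ultimately show ?thesis using False by (simp add: ins_last)
  qed
qed

text \<open>The rule of the generating tree: from slack d, the admissible v up to n give slacks d,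
  ..., 1, and the top value gives d + 1.\<close>

lemma slack_ins:
  assumes p: "p permutes {1..n}" and v: "inv_bottom n p < v" "v \<le> Suc n"
  shows "slack (Suc n) (ins n v p) = (if v = Suc n then Suc (slack n p) else Suc n - v)"
  using inv_bottom_ins[OF assms] inv_bottom_le[OF p] by (simp add: slack_def Suc_diff_le)

lemma Des_ins:
  "Des (Suc n) (ins n v p) = Des n p \<union> (if 1 \<le> n \<and> v \<le> p n then {n} else {})"
proof (rule set_eqI)
  fix i
  show "i \<in> Des (Suc n) (ins n v p) \<longleftrightarrow> i \<in> Des n p \<union> (if 1 \<le> n \<and> v \<le> p n then {n} else {})"
  proof (cases "i = n")
    case True
    then show ?thesis by (auto simp: Des_def ins_last last_less_ins_iff)
  next
    case False
    then show ?thesis by (auto simp: Des_def ins_less_iff)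
  qed
qed

lemma perms_321_ins:
  assumes "p \<in> perms_321 n" "inv_bottom n p < v" "v \<le> Suc n"
  shows "ins n v p \<in> perms_321 (Suc n)"
  using assms permutes_ins[of p n v] by (simp add: perms_321_def avoids_ins_iff)

lemma perms_321_Suc_cases:
  assumes "q \<in> perms_321 (Suc n)"
  obtains p v where "p \<in> perms_321 n" "inv_bottom n p < v" "v \<le> Suc n" "q = ins n v p"
proof -
  from assms have q: "q permutes {1..Suc n}" by (simp add: perms_321_def)
  from permutes_Suc_ins[OF q] obtain p
    where p: "p permutes {1..n}" and e: "q = ins n (q (Suc n)) p" .
  have v: "1 \<le> q (Suc n)" "q (Suc n) \<le> Suc n"
    using permutes_pos[OF q] permutes_le[OF q] by auto
  have "avoids_321 (Suc n) (ins n (q (Suc n)) p)"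
    using assms e by (simp add: perms_321_def)
  with v have "avoids_321 n p" "inv_bottom n p < q (Suc n)"
    by (simp_all add: avoids_ins_iff)
  with p v e that show ?thesis by (auto simp: perms_321_def)
qed

text \<open>If n is not last, it stands earlier and forms an inversion with the last entry. This is
  why a descent created by an admissible insertion needs the top value just before it.\<close>

lemma last_eq_or_le_inv_bottom:
  assumes p: "p permutes {1..n}" and n: "1 \<le> n"
  shows "p n = n \<or> p n \<le> inv_bottom n p"
proof (cases "p n = n")
  case False
  have "n \<in> p ` {1..n}"
    unfolding permutes_image[OF p] using n by simp
  then obtain i where i: "i \<in> {1..n}" "p i = n"
    by blast
  with False have "i < n" by (cases "i = n") auto
  moreover have "p n < p i"
    using False permutes_le[OF p, of n] i by simp
  ultimately show ?thesis using le_inv_bottom[of i n n p] i by simp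
qed simp

lemma finite_perms_321: "finite (perms_321 n)"
  by (rule finite_subset[OF _ finite_permutations[of "{1..n}"]]) (auto simp: perms_321_def)

section \<open>Children with a prescribed slack\<close>

text \<open>A permutation has a child of slack \<open>Suc d\<close> iff its slack is at least d, and
  then exactly one. Only position n can become a descent, and n is not in S.\<close>

lemma card_slack_Suc:
  assumes S: "S \<subseteq> {1..n - 1}"
  shows "card {q \<in> perms_321 (Suc n). S \<subseteq> Des (Suc n) q \<and> slack (Suc n) q = Suc d} =
    card {p \<in> perms_321 n. S \<subseteq> Des n p \<and> d \<le> slack n p}" (is "card ?Q = card ?P")
proof -
  \<comment> \<open>This solves the slack rule for v: \<open>Suc n - v = Suc d\<close> gives
    \<open>n - d\<close>, which is admissible only for d below the slack. For d equal to the slack,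
    the top value is the one that works.\<close>
  define f where "f p = ins n (if d = slack n p then Suc n else n - d) p" for p
  have SD: "S \<subseteq> Des (Suc n) (ins n v p) \<longleftrightarrow> S \<subseteq> Des n p" for v p
  proof -
    have "n \<notin> S" using subsetD[OF S, of n] by auto
    then show ?thesis by (auto simp: Des_ins)
  qed
  have inj_f: "inj_on f ?P"
  proof (rule inj_onI)
    fix p q assume a: "p \<in> ?P" "q \<in> ?P" "f p = f q"
    then have "p permutes {1..n}" "q permutes {1..n}" by (auto simp: perms_321_def)
    then show "p = q"
      using a(3) unfolding f_def by (rule ins_eqD(2))
  qed
  have "f ` ?P \<subseteq> ?Q"
  proof clarify
    fix p assume a: "p \<in> perms_321 n" "S \<subseteq> Des n p" "d \<le> slack n p"
    then have p: "p permutes {1..n}" by (simp add: perms_321_def)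
    note b = inv_bottom_le[OF p]
    let ?v = "if d = slack n p then Suc n else n - d"
    have v: "inv_bottom n p < ?v" "?v \<le> Suc n"
      using a b by (auto simp: slack_def)
    show "f p \<in> perms_321 (Suc n) \<and> S \<subseteq> Des (Suc n) (f p) \<and> slack (Suc n) (f p) = Suc d"
      using perms_321_ins[OF a(1) v] slack_ins[OF p v] a b
      unfolding f_def SD by (auto simp: slack_def)
  qed
  moreover have "?Q \<subseteq> f ` ?P"
  proof clarify
    fix q assume a: "q \<in> perms_321 (Suc n)" "S \<subseteq> Des (Suc n) q" "slack (Suc n) q = Suc d"
    from perms_321_Suc_cases[OF a(1)] obtain p v
      where p: "p \<in> perms_321 n" and v: "inv_bottom n p < v" "v \<le> Suc n" and q: "q = ins n v p" .
    from p have pp: "p permutes {1..n}" by (simp add: perms_321_def)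
    have sl: "(if v = Suc n then Suc (slack n p) else Suc n - v) = Suc d"
      using a(3) slack_ins[OF pp v] q by simp
    have "d \<le> slack n p" "v = (if d = slack n p then Suc n else n - d)"
      using sl v by (auto simp: slack_def split: if_splits)
    then show "q \<in> f ` ?P"
      using p a(2) q SD by (auto simp: f_def)
  qed
  ultimately have "f ` ?P = ?Q" by (rule subset_antisym)
  then show ?thesis using card_image[OF inj_f] by argo
qed

text \<open>The same right-hand side as in \<open>card_slack_Suc\<close>: two steps with a forced descent between them
  act on slacks as one free step.\<close>

lemma card_slack_Suc_descent:
  assumes S: "S \<subseteq> {1..n - 1}"
  shows "card {q \<in> perms_321 (Suc (Suc n)).
      insert (Suc n) S \<subseteq> Des (Suc (Suc n)) q \<and> slack (Suc (Suc n)) q = Suc d} =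
    card {p \<in> perms_321 n. S \<subseteq> Des n p \<and> d \<le> slack n p}" (is "card ?Q = card ?P")
proof -
  \<comment> \<open>Appending the top value raises the slack by one and keeps the inversion bottoms.
    The second value solves \<open>Suc (Suc n) - v = Suc d\<close>; it is never the top value, so no
    case distinction arises.\<close>
  define f where "f p = ins (Suc n) (Suc n - d) (ins n (Suc n) p)" for p
  have SD: "S \<subseteq> Des (Suc (Suc n)) (ins (Suc n) v (ins n w p)) \<longleftrightarrow> S \<subseteq> Des n p" for v w p
  proof -
    have "n \<notin> S" "Suc n \<notin> S" using subsetD[OF S, of n] subsetD[OF S, of "Suc n"] by auto
    then show ?thesis by (auto simp: Des_ins)
  qed
  \<comment> \<open>\<open>Des (Suc n) p\<close> stops at n, so the last insertion alone decides
    about position \<open>Suc n\<close>.\<close>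
  have DD: "Suc n \<in> Des (Suc (Suc n)) (ins (Suc n) v p) \<longleftrightarrow> v \<le> p (Suc n)" for v p
    by (auto simp: Des_ins) (auto simp: Des_def)
  have inj_f: "inj_on f ?P"
  proof (rule inj_onI)
    fix p q assume a: "p \<in> ?P" "q \<in> ?P" "f p = f q"
    then have pq: "p permutes {1..n}" "q permutes {1..n}" by (auto simp: perms_321_def)
    from this have "ins n (Suc n) p permutes {1..Suc n}" "ins n (Suc n) q permutes {1..Suc n}"
      using permutes_ins[of _ n "Suc n"] by simp_all
    then have "ins n (Suc n) p = ins n (Suc n) q"
      using a(3) unfolding f_def by (rule ins_eqD(2))
    with pq show "p = q" by (rule ins_eqD(2))
  qed
  have "f ` ?P \<subseteq> ?Q"
  proof clarify
    fix p assume a: "p \<in> perms_321 n" "S \<subseteq> Des n p" "d \<le> slack n p"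
    then have p: "p permutes {1..n}" by (simp add: perms_321_def)
    note b = inv_bottom_le[OF p]
    have w: "inv_bottom n p < Suc n" using b by simp
    let ?p = "ins n (Suc n) p"
    have p1: "?p \<in> perms_321 (Suc n)" "?p permutes {1..Suc n}"
      using perms_321_ins[OF a(1) w] by (auto simp: perms_321_def)
    have v: "inv_bottom (Suc n) ?p < Suc n - d" "Suc n - d \<le> Suc (Suc n)"
      using inv_bottom_ins[OF p w] a b by (auto simp: slack_def)
    show "f p \<in> perms_321 (Suc (Suc n)) \<and> insert (Suc n) S \<subseteq> Des (Suc (Suc n)) (f p) \<and>
        slack (Suc (Suc n)) (f p) = Suc d"
      using perms_321_ins[OF p1(1) v] slack_ins[OF p1(2) v] a b
      unfolding f_def insert_subset SD DD by (auto simp: slack_def ins_last)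
  qed
  moreover have "?Q \<subseteq> f ` ?P"
  proof clarify
    fix q
    assume a: "q \<in> perms_321 (Suc (Suc n))" "insert (Suc n) S \<subseteq> Des (Suc (Suc n)) q"
      "slack (Suc (Suc n)) q = Suc d"
    from perms_321_Suc_cases[OF a(1)] obtain p v where p: "p \<in> perms_321 (Suc n)"
      and v: "inv_bottom (Suc n) p < v" "v \<le> Suc (Suc n)" and q: "q = ins (Suc n) v p" .
    from perms_321_Suc_cases[OF p] obtain r w where r: "r \<in> perms_321 n"
      and w: "inv_bottom n r < w" "w \<le> Suc n" and pr: "p = ins n w r" .
    from p have pp: "p permutes {1..Suc n}" by (simp add: perms_321_def)
    from r have rr: "r permutes {1..n}" by (simp add: perms_321_def)
    have vp: "v \<le> p (Suc n)" using a(2) by (simp add: q DD)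
    \<comment> \<open>The entry before v is at least v, hence above every inversion bottom, which
      leaves only the top value.\<close>
    then have pn: "p (Suc n) = Suc n"
      using last_eq_or_le_inv_bottom[OF pp] v by auto
    then have wn: "w = Suc n" by (simp add: pr ins_last)
    have "inv_bottom (Suc n) p = inv_bottom n r"
      using inv_bottom_ins[OF rr w] pr wn by simp
    moreover have "Suc (Suc n) - v = Suc d"
      using a(3) slack_ins[OF pp v] vp pn by (simp add: q)
    ultimately have "d \<le> slack n r" "v = Suc n - d"
      using v by (auto simp: slack_def)
    then show "q \<in> f ` ?P"
      using r a(2) SD by (auto simp: f_def q pr wn)
  qed
  ultimately have "f ` ?P = ?Q" by (rule subset_antisym)
  then show ?thesis using card_image[OF inj_f] by argo
qed


section \<open>Slack distributions and removal of forced descents\<close>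

definition slack_card :: "nat \<Rightarrow> nat set \<Rightarrow> nat \<Rightarrow> nat" where
  "slack_card n S d = card {p \<in> perms_321 n. S \<subseteq> Des n p \<and> slack n p = d}"

text \<open>Tails of the distribution are what the recursions return: the count at slack
  \<open>Suc d\<close> is the tail from d of an earlier level.\<close>

definition slack_card_ge :: "nat \<Rightarrow> nat set \<Rightarrow> nat \<Rightarrow> nat" where
  "slack_card_ge n S d = card {p \<in> perms_321 n. S \<subseteq> Des n p \<and> d \<le> slack n p}"

lemma slack_card_ge_step:
  "slack_card_ge n S d = slack_card n S d + slack_card_ge n S (Suc d)"
proof -
  let ?X = "{p \<in> perms_321 n. S \<subseteq> Des n p \<and> slack n p = d}"
  let ?Y = "{p \<in> perms_321 n. S \<subseteq> Des n p \<and> Suc d \<le> slack n p}"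
  have "{p \<in> perms_321 n. S \<subseteq> Des n p \<and> d \<le> slack n p} = ?X \<union> ?Y"
    by auto
  moreover have "card (?X \<union> ?Y) = card ?X + card ?Y"
    by (rule card_Un_disjoint) (auto simp: finite_perms_321)
  ultimately show ?thesis
    unfolding slack_card_def slack_card_ge_def by simp
qed

lemma slack_card_ge_eq_0:
  assumes "n < d"
  shows "slack_card_ge n S d = 0"
proof -
  have "\<not> d \<le> slack n p" for p using assms by (simp add: slack_def)
  then have "{p \<in> perms_321 n. S \<subseteq> Des n p \<and> d \<le> slack n p} = {}"
    by simp
  then show ?thesis unfolding slack_card_ge_def by (simp only: card.empty)
qed

text \<open>Every child has slack at least 1; this supplies the one value that the recursions for
  \<open>Suc d\<close> leave open.\<close>

lemma slack_card_Suc_0: "slack_card (Suc n) S 0 = 0"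
proof -
  have "slack (Suc n) q \<noteq> 0" if "q \<in> perms_321 (Suc n)" for q
    using that
  proof (rule perms_321_Suc_cases)
    fix p v
    assume a: "p \<in> perms_321 n" "inv_bottom n p < v" "v \<le> Suc n" "q = ins n v p"
    then have "p permutes {1..n}" by (simp add: perms_321_def)
    then show ?thesis using slack_ins[of p n v] a by simp
  qed
  then have "{q \<in> perms_321 (Suc n). S \<subseteq> Des (Suc n) q \<and> slack (Suc n) q = 0} = {}"
    by blast
  then show ?thesis unfolding slack_card_def by (simp only: card.empty)
qed

lemma slack_card_Suc:
  assumes "S \<subseteq> {1..n - 1}"
  shows "slack_card (Suc n) S (Suc d) = slack_card_ge n S d"
  unfolding slack_card_def slack_card_ge_def by (rule card_slack_Suc[OF assms])

lemma slack_card_Suc_descent: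
  assumes "S \<subseteq> {1..n - 1}"
  shows "slack_card (Suc (Suc n)) (insert (Suc n) S) (Suc d) = slack_card_ge n S d"
  unfolding slack_card_def slack_card_ge_def by (rule card_slack_Suc_descent[OF assms])

text \<open>Descending induction on t, starting above both n and m, where both tails vanish.\<close>

lemma slack_card_ge_cong:
  assumes "\<And>d. slack_card n S d = slack_card m T d"
  shows "slack_card_ge n S t = slack_card_ge m T t"
proof (induction "Suc (max n m) - t" arbitrary: t)
  case 0
  then show ?case by (simp add: slack_card_ge_eq_0)
next
  case (Suc x)
  then have "x = Suc (max n m) - Suc t" by simp
  then have "slack_card_ge n S (Suc t) = slack_card_ge m T (Suc t)" by (rule Suc(1))
  then show ?case
    using slack_card_ge_step[of n S t] slack_card_ge_step[of m T t] assms[of t] by simp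
qed

text \<open>Peel off the last level and compare whole distributions. If \<open>n - 1\<close> is not
  in S, one step is undone on each side; if it is, two steps on the left match one on the right. The
  drop by two calls for strong induction.\<close>

lemma slack_card_ge_descents:
  assumes "S \<subseteq> {1..n - 1}" "\<And>i. i \<in> S \<Longrightarrow> Suc i \<notin> S"
  shows "slack_card_ge n S t = slack_card_ge (n - card S) {} t"
  using assms
proof (induction n arbitrary: S t rule: less_induct)
  case (less n)
  show ?case
  proof (cases n)
    case 0
    then have "S = {}" using less.prems(1) by simp
    then show ?thesis by simp
  next
    case n: (Suc m)
    have fin: "finite S" using less.prems(1) finite_subset by blast
    show ?thesis
    proof (cases "m \<in> S")
      case False
      have sub: "S \<subseteq> {1..m - 1}"
      proof
        fix x assume x: "x \<in> S"
        then have "x \<noteq> m" using False by blast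
        then show "x \<in> {1..m - 1}" using subsetD[OF less.prems(1) x] n by auto
      qed
      \<comment> \<open>Needed so that the truncated difference \<open>n - card S\<close> is a
        successor.\<close>
      have "card S \<le> m - 1" using card_mono[OF _ sub] by simp
      then have nS: "n - card S = Suc (m - card S)" using n by simp
      have IH: "slack_card_ge m S d = slack_card_ge (m - card S) {} d" for d
        using less.IH[of m S d] n sub less.prems(2) by simp
      have "slack_card n S d = slack_card (n - card S) {} d" for d
        unfolding nS unfolding n
        by (cases d) (simp_all add: slack_card_Suc_0 slack_card_Suc[OF sub] slack_card_Suc IH)
      then show ?thesis by (rule slack_card_ge_cong)
    next
      case True
      then have "m \<noteq> 0" using subsetD[OF less.prems(1) True] by simp
      then obtain k where m: "m = Suc k" by (cases m) simp_all
      define T where "T = S - {m}"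
      have S: "S = insert (Suc k) T" using True by (auto simp: T_def m)
      \<comment> \<open>The absence of consecutive elements enters here: it puts the remaining set T
        within \<open>{1..k - 1}\<close>, as the two-step recursion requires.\<close>
      have kS: "k \<notin> S" using less.prems(2)[of k] True m by blast
      have sub: "T \<subseteq> {1..k - 1}"
      proof
        fix x assume x: "x \<in> T"
        then have "x \<noteq> k" "x \<noteq> m" "x \<in> S" using kS by (auto simp: T_def)
        then show "x \<in> {1..k - 1}" using subsetD[OF less.prems(1), of x] n m by auto
      qed
      have cS: "card S = Suc (card T)" unfolding T_def by (rule card.remove[OF fin True])
      have "card T \<le> k - 1" using card_mono[OF _ sub] by simp
      then have nS: "n - card S = Suc (k - card T)" using n m cS by simp
      have IH: "slack_card_ge k T d = slack_card_ge (k - card T) {} d" for d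
        using less.IH[of k T d] n m sub less.prems(2) by (simp add: T_def)
      have "slack_card n S d = slack_card (n - card S) {} d" for d
        unfolding nS unfolding n m S
        by (cases d) (simp_all add: slack_card_Suc_0 slack_card_Suc_descent[OF sub] slack_card_Suc IH)
      then show ?thesis by (rule slack_card_ge_cong)
    qed
  qed
qed

section \<open>Ballot numbers and the Catalan count\<close>

text \<open>The unconstrained tails are ballot numbers, written additively to avoid truncated
  subtraction. For fixed n the induction descends in t, since \<open>Suc_t\<close> expresses a tail
  through the next one and a tail one level below; Pascal's rule matches this.\<close>

lemma slack_card_ge_ballot:
  "t \<le> n \<Longrightarrow> slack_card_ge n {} t + (2 * n - t choose Suc n) = (2 * n - t choose n)"
proof (induction n arbitrary: t)
  case 0
  have "perms_321 0 = {id}"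
    by (simp add: perms_321_def avoids_321_def)
  with 0 show ?case by (simp add: slack_card_ge_def)
next
  case (Suc n)
  have Suc_t: "slack_card_ge (Suc n) {} (Suc t) =
      slack_card_ge n {} t + slack_card_ge (Suc n) {} (Suc (Suc t))" for t
    using slack_card_ge_step[of "Suc n" "{}" "Suc t"] slack_card_Suc[of "{}" n t] by simp
  from Suc.prems show ?case
  proof (induction t rule: inc_induct)
    case base
    have "slack_card_ge n {} n = 1"
      using Suc.IH[of n] by (simp add: binomial_eq_0)
    then show ?case
      using Suc_t[of n] slack_card_ge_eq_0[of "Suc n" "Suc (Suc n)" "{}"]
      by (simp add: binomial_eq_0)
  next
    case (step t)
    define k where "k = 2 * Suc n - Suc t"
    have k: "2 * Suc n - t = Suc k" "2 * Suc n - Suc t = k"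
      using step.hyps by (simp_all add: k_def)
    have IH: "slack_card_ge (Suc n) {} (Suc t) + (k choose Suc (Suc n)) = (k choose Suc n)"
      using step.IH unfolding k .
    show ?case
    proof (cases t)
      case 0
      \<comment> \<open>No permutation here has slack 0, so the tail does not change;
        correspondingly, the extra Pascal terms agree by symmetry, as k is
        \<open>2 * n + 1\<close>.\<close>
      have "slack_card_ge (Suc n) {} 0 = slack_card_ge (Suc n) {} (Suc 0)"
        using slack_card_ge_step[of "Suc n" "{}" 0] slack_card_Suc_0[of n "{}"] by simp
      moreover have "k - n = Suc n" "n \<le> k" using 0 by (simp_all add: k_def)
      then have "(k choose n) = (k choose Suc n)"
        using binomial_symmetric[of n k] by simp
      ultimately show ?thesis
        using IH unfolding k binomial_Suc_Suc unfolding 0 by linarith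
    next
      case (Suc s)
      then have "s \<le> n" "2 * n - s = k" using step.hyps by (simp_all add: k_def)
      \<comment> \<open>Adding this instance for n to \<open>IH\<close> gives both sides of the goal
        after Pascal's rule.\<close>
      then have "slack_card_ge n {} s + (k choose Suc n) = (k choose n)"
        using Suc.IH[of s] by metis
      then show ?thesis
        using IH Suc_t[of s] unfolding k binomial_Suc_Suc unfolding Suc by linarith
    qed
  qed
qed

text \<open>The ballot number at t = 0 is a difference of two binomials. Absorption turns
  \<open>Suc n\<close> times the subtracted one into n times the central one, so
  \<open>Suc n\<close> times the count is the central binomial and the division in
  \<open>catalan\<close> is exact.\<close>

lemma slack_card_ge_0: "slack_card_ge n {} 0 = catalan n"
proof -
  have 1: "slack_card_ge n {} 0 + (2 * n choose Suc n) = (2 * n choose n)"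
    using slack_card_ge_ballot[of 0 n] by simp
  have "Suc n * (2 * n choose Suc n) = n * (2 * n choose n)"
    using binomial_absorb_comp[of "2 * n" n] binomial_absorption[of n "2 * n"] by auto
  moreover have "Suc n * slack_card_ge n {} 0 + Suc n * (2 * n choose Suc n) =
      Suc n * (2 * n choose n)"
    using arg_cong[OF 1, of "(*) (Suc n)"] by (simp only: add_mult_distrib2)
  ultimately have "Suc n * slack_card_ge n {} 0 = (2 * n choose n)"
    by simp
  then have "(2 * n choose n) div Suc n = slack_card_ge n {} 0"
    by (metis nonzero_mult_div_cancel_left Suc_neq_Zero)
  then show ?thesis by (simp add: catalan_def)
qed

theorem theorem5p1:
  fixes n :: nat and S :: "nat set"
  assumes "S \<subseteq> {1..n - 1}"
  shows "card {p \<in> perms_321 n. S \<subseteq> Des n p} =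
    (if \<forall>i. \<not> (i \<in> S \<and> i + 1 \<in> S) then catalan (n - card S) else 0)"
proof (cases "\<forall>i. \<not> (i \<in> S \<and> i + 1 \<in> S)")
  case True
  have "card {p \<in> perms_321 n. S \<subseteq> Des n p} = slack_card_ge n S 0"
    by (simp add: slack_card_ge_def)
  also have "\<dots> = slack_card_ge (n - card S) {} 0"
    by (rule slack_card_ge_descents[OF assms]) (metis True Suc_eq_plus1)
  finally show ?thesis unfolding slack_card_ge_0 using True by argo
next
  case False
  then obtain i where i: "i \<in> S" "Suc i \<in> S" unfolding Suc_eq_plus1 by blast
  \<comment> \<open>Descents at i and \<open>Suc i\<close> are a 321 pattern on three adjacent
    positions.\<close>
  have "\<not> S \<subseteq> Des n p" if "p \<in> perms_321 n" for p
  proof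
    assume "S \<subseteq> Des n p"
    then have "i \<in> Des n p" "Suc i \<in> Des n p" using i by (simp_all only: subsetD)
    then have "1 \<le> i" "Suc (Suc i) \<le> n" "p (Suc i) < p i" "p (Suc (Suc i)) < p (Suc i)"
      by (auto simp: Des_def)
    moreover have "avoids_321 n p" using that by (simp add: perms_321_def)
    ultimately show False using avoids_321D[of n p i "Suc i" "Suc (Suc i)"] by simp
  qed
  then have "{p \<in> perms_321 n. S \<subseteq> Des n p} = {}" by simp
  then show ?thesis using False by (simp only: card.empty if_False)
qed

end
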